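(* There exists a positive and contractive operator $T\colon \ell^\infty\to\ell^\infty$ such that $T$ is mean ergodic while $T^{2j}$ is not mean ergodic for any $j\in\mathbb{N}=\{1,2,3,\dots\}$. In particular, $T$ is not weakly almost periodic.
   Context: "Operator" means linear operator. $\ell^\infty$ is the Banach lattice of bounded real sequences with the supremum norm and the coordinatewise order. An operator is positive if it maps the positive cone into itself, and contractive if its operator norm is at most $1$. A bounded linear operator $T$ on a Banach space $X$ is called mean ergodic if the limit $\lim_{n\to\infty}\frac{1}{n}\sum_{k=0}^{n-1}T^k x$ exists (in norm) for every $x\in X$. It is called weakly almost periodic if $\{T^n x : n\in\mathbb{N}\}$ is relatively weakly compact in $X$ for every $x\in X$. *)

theory Defs
  imports "HOL-Analysis.Analysis"
begin

text \<open>
  Since \<open>nat\<close> carries the discrete topology, continuity is vacuous and the library's space of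
  bounded continuous functions with the supremum norm is the space of bounded real sequences.
\<close>

type_synonym linfty = "nat \<Rightarrow>\<^sub>C real"

lemma nat_bcontfun_iff_bounded: "f \<in> bcontfun \<longleftrightarrow> bounded (range f)"
  for f :: "nat \<Rightarrow> real"
  by (simp add: bcontfun_def)

lemma norm_linfty: "norm x = (SUP n. \<bar>apply_bcontfun x n\<bar>)"
  for x :: linfty
  by (simp add: norm_bcontfun_def dist_bcontfun_def dist_real_def)

text \<open>The library puts no order on \<open>linfty\<close>; the coordinatewise order enters only through its
  positive cone.\<close>

definition linfty_cone :: "linfty set" where
  "linfty_cone = {x. \<forall>n. 0 \<le> apply_bcontfun x n}"

definition positive_operator :: "(linfty \<Rightarrow> linfty) \<Rightarrow> bool" where
  "positive_operator T \<longleftrightarrow> T ` linfty_cone \<subseteq> linfty_cone"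

text \<open>Boundedness and linearity of \<open>T\<close> are not part of the following predicates, so that their
  negations do not hold merely because of a failure of boundedness or linearity.\<close>

definition mean_ergodic :: "('a::real_normed_vector \<Rightarrow> 'a) \<Rightarrow> bool" where
  "mean_ergodic T \<longleftrightarrow> (\<forall>x. convergent (\<lambda>n. (1 / real n) *\<^sub>R (\<Sum>k<n. (T ^^ k) x)))"

text \<open>The weak topology is the initial topology of the family of all bounded linear functionals;
  \<open>euclidean\<close> is here the product topology on real-valued functions on the dual.\<close>

definition weak_topology :: "'a::real_normed_vector topology" where
  "weak_topology =
     pullback_topology UNIV (\<lambda>x (\<phi> :: 'a \<Rightarrow>\<^sub>L real). blinfun_apply \<phi> x) euclidean"

definition relatively_weakly_compact :: "'a::real_normed_vector set \<Rightarrow> bool" where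
  "relatively_weakly_compact S \<longleftrightarrow> compactin weak_topology (weak_topology closure_of S)"

definition weakly_almost_periodic :: "('a::real_normed_vector \<Rightarrow> 'a) \<Rightarrow> bool" where
  "weakly_almost_periodic T \<longleftrightarrow>
     (\<forall>x. relatively_weakly_compact {(T ^^ n) x | n :: nat. n \<ge> 1})"

end

theory Submission
  imports Defs
begin

text \<open>
  Let \<open>T\<close> be the direct sum of the stochastic blocks with rows
  \<open>((1 - r)/2, (1 + r)/2)\<close> and \<open>((1 + r)/2, (1 - r)/2)\<close>, where \<open>r = m/(m + 1)\<close> in block \<open>m\<close>.
  The eigenvalues of a block are \<open>1\<close> and \<open>-r\<close>. Since \<open>-r\<close> stays away from \<open>1\<close>, the Cesaro
  means of \<open>T\<close> converge uniformly over the blocks; in an even power the eigenvalue \<open>-r\<close> becomes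
  \<open>r ^ (2 * j)\<close>, which accumulates at \<open>1\<close>, and uniformity is lost on the vector \<open>(1, -1, 1, -1, \<dots>)\<close>.
  The orbit of this vector tends to \<open>0\<close> in each coordinate, while a generalized limit along the
  even coordinates has modulus \<open>1\<close> on the whole orbit, so the orbit is not relatively weakly
  compact.
\<close>

section \<open>The weak topology\<close>

lemma topspace_weak_topology [simp]: "topspace weak_topology = UNIV"
  by (simp add: weak_topology_def topspace_pullback_topology)

lemma continuous_map_weak_topology:
  "continuous_map weak_topology euclideanreal (blinfun_apply \<phi>)"
proof -
  have "continuous_map euclidean euclideanreal (\<lambda>g :: ('a \<Rightarrow>\<^sub>L real) \<Rightarrow> real. g \<phi>)"
    by simp
  from continuous_map_pullback[OF this, of UNIV "\<lambda>x \<phi>. blinfun_apply \<phi> x"]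
  show ?thesis
    unfolding weak_topology_def by (simp add: o_def)
qed

lemma bounded_linear_coordinate: "bounded_linear (\<lambda>x :: linfty. apply_bcontfun x m)"
  by (rule bounded_linear_intro[where K = 1]) (auto intro: norm_bounded[where 'b = real, simplified])

lemma continuous_map_weak_topology_coordinate:
  "continuous_map weak_topology euclideanreal (\<lambda>x :: linfty. apply_bcontfun x m)"
  using continuous_map_weak_topology[of "Blinfun (\<lambda>x :: linfty. apply_bcontfun x m)"]
  by (simp add: bounded_linear_Blinfun_apply[OF bounded_linear_coordinate])

text \<open>The functional is a cluster point of the evaluations at the coordinates \<open>s m\<close> in the product
  topology; it exists by Tychonoff's theorem.\<close>

lemma generalized_limit_exists:
  fixes s :: "nat \<Rightarrow> nat"
  obtains \<phi> :: "linfty \<Rightarrow>\<^sub>L real"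
  where "\<And>x l. (\<lambda>m. apply_bcontfun x (s m)) \<longlonglongrightarrow> l \<Longrightarrow> blinfun_apply \<phi> x = l"
proof -
  define F where "F = filtermap (\<lambda>m (x :: linfty). apply_bcontfun x (s m)) sequentially"
  \<comment> \<open>Every evaluation satisfies the norm bound that defines this product of compact
    intervals; the cluster point inherits it by lying in \<open>K\<close>, which later bounds the
    functional.\<close>
  define K where "K = PiE UNIV (\<lambda>x :: linfty. cball (0::real) (norm x))"
  have "compact K"
    using compactin_PiE[of "\<lambda>_::linfty. euclideanreal" UNIV "\<lambda>x. cball 0 (norm x)"]
    by (simp add: K_def euclidean_product_topology compactin_euclidean_iff)
  moreover have "F \<noteq> bot"
    by (simp add: F_def filtermap_bot_iff)
  moreover have "eventually (\<lambda>f. f \<in> K) F"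
    using norm_bounded[where 'b = real]
    by (auto simp: F_def K_def eventually_filtermap PiE_iff intro!: always_eventually)
  ultimately obtain f where f: "f \<in> K" "inf (nhds f) F \<noteq> bot"
    unfolding compact_filter by blast
  \<comment> \<open>\<open>G\<close> converges to \<open>f\<close> and refines \<open>F\<close>.
    Identities shared by all evaluations hold along \<open>G\<close>, so linearity passes to
    \<open>f\<close>; limits along \<open>s\<close> are limits along \<open>F\<close>, hence along
    \<open>G\<close>.\<close>
  define G where "G = inf (nhds f) F"
  have G: "G \<noteq> bot" "G \<le> nhds f" "G \<le> F"
    using f by (simp_all add: G_def)
  have lim: "((\<lambda>g. g x) \<longlongrightarrow> f x) G" for x
  proof -
    have "((\<lambda>g. g x) \<longlongrightarrow> f x) (nhds f)"
    proof (rule topological_tendstoI)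
      fix S assume "open S" "f x \<in> S"
      moreover have "open ((\<lambda>g. g x) -` S)"
        by (rule open_vimage[OF \<open>open S\<close> continuous_on_product_coordinates])
      ultimately show "eventually (\<lambda>g. g x \<in> S) (nhds f)"
        unfolding eventually_nhds by (intro exI[of _ "(\<lambda>g. g x) -` S"]) auto
    qed
    then show ?thesis
      using G(2) by (rule tendsto_mono[rotated])
  qed
  have ev: "eventually P G" if "\<And>m. P (\<lambda>x. apply_bcontfun x (s m))" for P
    using that by (auto intro!: filter_leD[OF G(3)] simp: F_def eventually_filtermap)
  have add: "f (x + y) = f x + f y" for x y
  proof -
    have "((\<lambda>g. g x + g y) \<longlongrightarrow> f (x + y)) G"
      by (rule Lim_transform_eventually[OF lim]) (rule ev, simp)
    moreover have "((\<lambda>g. g x + g y) \<longlongrightarrow> f x + f y) G"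
      by (intro tendsto_add lim)
    ultimately show ?thesis
      using tendsto_unique G(1) by blast
  qed
  have scale: "f (c *\<^sub>R x) = c *\<^sub>R f x" for c x
  proof -
    have "((\<lambda>g. c *\<^sub>R g x) \<longlongrightarrow> f (c *\<^sub>R x)) G"
      by (rule Lim_transform_eventually[OF lim]) (rule ev, simp)
    moreover have "((\<lambda>g. c *\<^sub>R g x) \<longlongrightarrow> c *\<^sub>R f x) G"
      by (intro tendsto_intros lim)
    ultimately show ?thesis
      using tendsto_unique G(1) by blast
  qed
  have "bounded_linear f"
    by (rule bounded_linear_intro[where K = 1]) (use f(1) in \<open>auto simp: add scale K_def PiE_iff\<close>)
  moreover have "f x = l" if "(\<lambda>m. apply_bcontfun x (s m)) \<longlonglongrightarrow> l" for x l
  proof -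
    have "((\<lambda>g. g x) \<longlongrightarrow> l) F"
      using that by (simp add: F_def filterlim_filtermap)
    then have "((\<lambda>g. g x) \<longlongrightarrow> l) G"
      using G(3) by (rule tendsto_mono[rotated])
    then show ?thesis
      using lim tendsto_unique G(1) by blast
  qed
  ultimately show ?thesis
    using that[of "Blinfun f"] by (simp add: bounded_linear_Blinfun_apply)
qed

text \<open>The modulus of \<phi> stays 1 on the weak closure of \<open>S\<close>, which therefore
  misses 0. If the closure were compact, finitely many conditions keeping one coordinate away from 0
  would cover it, but \<open>f n\<close> eventually violates all of them.\<close>

lemma not_relatively_weakly_compactI:
  fixes f :: "nat \<Rightarrow> linfty" and \<phi> :: "linfty \<Rightarrow>\<^sub>L real"
  assumes S: "\<And>n. f n \<in> S"
    and coord: "\<And>m. (\<lambda>n. apply_bcontfun (f n) m) \<longlonglongrightarrow> 0"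
    and \<phi>: "\<And>y. y \<in> S \<Longrightarrow> \<bar>blinfun_apply \<phi> y\<bar> = 1"
  shows "\<not> relatively_weakly_compact S"
proof
  assume "relatively_weakly_compact S"
  then have cpt: "compactin weak_topology (weak_topology closure_of S)" (is "compactin _ ?K")
    by (simp add: relatively_weakly_compact_def)
  define U where "U = (\<lambda>(m, e). {y :: linfty. e < \<bar>apply_bcontfun y m\<bar>})"
  have "continuous_map weak_topology euclideanreal (\<lambda>y. \<bar>blinfun_apply \<phi> y\<bar>)"
    by (intro continuous_map_real_abs continuous_map_weak_topology)
  from closedin_continuous_map_preimage[OF this, of "{1}"]
  have "closedin weak_topology {y. \<bar>blinfun_apply \<phi> y\<bar> = 1}"
    by simp
  then have K1: "?K \<subseteq> {y. \<bar>blinfun_apply \<phi> y\<bar> = 1}"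
    using \<phi> by (intro closure_of_minimal) auto
  have "?K \<subseteq> \<Union>(U ` (UNIV \<times> {0<..}))"
  proof
    fix y assume "y \<in> ?K"
    then have "y \<noteq> 0"
      using K1 by auto
    then obtain m where "apply_bcontfun y m \<noteq> 0"
      by (metis bcontfun_eqI zero_bcontfun.rep_eq)
    then have "y \<in> U (m, \<bar>apply_bcontfun y m\<bar> / 2)" "\<bar>apply_bcontfun y m\<bar> / 2 > 0"
      by (auto simp: U_def)
    then show "y \<in> \<Union>(U ` (UNIV \<times> {0<..}))"
      by blast
  qed
  moreover have "openin weak_topology (U p)" for p
  proof -
    have "continuous_map weak_topology euclideanreal (\<lambda>y :: linfty. \<bar>apply_bcontfun y (fst p)\<bar>)"
      by (intro continuous_map_real_abs continuous_map_weak_topology_coordinate)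
    from openin_continuous_map_preimage[OF this, of "{snd p<..}"]
    show ?thesis
      by (simp add: U_def case_prod_beta)
  qed
  ultimately obtain \<F> where "finite \<F>" "\<F> \<subseteq> U ` (UNIV \<times> {0<..})" "?K \<subseteq> \<Union>\<F>"
    using cpt unfolding compactin_def by (metis (no_types, lifting) imageE)
  then obtain P where P: "finite P" "P \<subseteq> UNIV \<times> {0<..}" "?K \<subseteq> \<Union>(U ` P)"
    by (metis finite_subset_image)
  have "eventually (\<lambda>n. f n \<notin> U p) sequentially" if "p \<in> P" for p
  proof -
    have "eventually (\<lambda>n. \<bar>apply_bcontfun (f n) (fst p)\<bar> < snd p) sequentially"
      using tendstoD[OF coord, of "snd p" "fst p"] that P(2) by auto
    then show ?thesis
      by eventually_elim (auto simp: U_def case_prod_beta)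
  qed
  then have "eventually (\<lambda>n. \<forall>p\<in>P. f n \<notin> U p) sequentially"
    using P(1) by (simp add: eventually_ball_finite)
  then obtain n where "\<forall>p\<in>P. f n \<notin> U p"
    using eventually_happens' sequentially_bot by blast
  moreover have "f n \<in> ?K"
    using S closure_of_subset[of S weak_topology] by auto
  ultimately show False
    using P(3) by auto
qed

section \<open>The operator\<close>

definition ratio :: "nat \<Rightarrow> real" where
  "ratio m = real m / real (Suc m)"

lemma ratio_nonneg: "0 \<le> ratio m"
  and ratio_less_one: "ratio m < 1"
  by (auto simp: ratio_def)

lemma ratio_tendsto: "ratio \<longlonglongrightarrow> 1"
  unfolding ratio_def using LIMSEQ_n_over_Suc_n by simp

text \<open>Block \<open>m\<close> occupies the coordinates \<open>2 * m\<close> and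
  \<open>2 * m + 1\<close>; \<open>swap\<close> exchanges the two.\<close>

definition swap :: "nat \<Rightarrow> nat" where
  "swap n = (if even n then Suc n else n - 1)"

lemma swap_swap [simp]: "swap (swap n) = n"
  by (auto simp: swap_def elim: oddE)

lemma swap_div_2 [simp]: "swap n div 2 = n div 2"
  by (auto simp: swap_def elim: oddE)

definition block :: "linfty \<Rightarrow> nat \<Rightarrow> real" where
  "block x n = (1 - ratio (n div 2)) / 2 * apply_bcontfun x n
             + (1 + ratio (n div 2)) / 2 * apply_bcontfun x (swap n)"

definition blockop :: "linfty \<Rightarrow> linfty" where
  "blockop x = Bcontfun (block x)"

text \<open>Each row is a convex combination: its two weights are nonnegative and add up to
  1.\<close>

lemma abs_block_le: "\<bar>block x n\<bar> \<le> norm x"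
proof -
  let ?r = "ratio (n div 2)"
  have "\<bar>block x n\<bar> \<le> (1 - ?r) / 2 * \<bar>apply_bcontfun x n\<bar> + (1 + ?r) / 2 * \<bar>apply_bcontfun x (swap n)\<bar>"
    using ratio_nonneg[of "n div 2"] ratio_less_one[of "n div 2"]
    by (auto simp: block_def abs_mult intro!: abs_triangle_ineq[THEN order_trans])
  also have "\<dots> \<le> (1 - ?r) / 2 * norm x + (1 + ?r) / 2 * norm x"
    using ratio_nonneg[of "n div 2"] ratio_less_one[of "n div 2"]
      norm_bounded[of x n] norm_bounded[of x "swap n"]
    by (intro add_mono mult_left_mono) auto
  also have "\<dots> = norm x"
    by (simp add: field_simps)
  finally show ?thesis .
qed

lemma apply_blockop [simp]: "apply_bcontfun (blockop x) n = block x n"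
proof -
  have "block x \<in> bcontfun"
    by (rule bcontfun_normI[where b = "norm x"]) (auto simp: abs_block_le)
  then show ?thesis
    by (simp add: blockop_def Bcontfun_inverse)
qed

lemma norm_blockop_le: "norm (blockop x) \<le> norm x"
  by (rule norm_bound) (simp add: abs_block_le)

lemma bounded_linear_blockop: "bounded_linear blockop"
  by (rule bounded_linear_intro[where K = 1])
    (auto intro!: bcontfun_eqI simp: norm_blockop_le block_def algebra_simps add_divide_distrib diff_divide_distrib)

lemma positive_operator_blockop: "positive_operator blockop"
  using ratio_nonneg ratio_less_one less_imp_le[OF ratio_less_one]
  by (auto simp: positive_operator_def linfty_cone_def block_def intro!: add_nonneg_nonneg mult_nonneg_nonneg)

lemma onorm_blockop_le: "onorm blockop \<le> 1"
  by (rule onorm_bound) (simp_all add: norm_blockop_le)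

text \<open>On each block the symmetric and antisymmetric parts of \<open>x\<close> are
  eigenvectors, with eigenvalues 1 and \<open>- ratio (n div 2)\<close>.\<close>

lemma apply_blockop_funpow:
  "apply_bcontfun ((blockop ^^ k) x) n =
     (apply_bcontfun x n + apply_bcontfun x (swap n)) / 2
   + (- ratio (n div 2)) ^ k * ((apply_bcontfun x n - apply_bcontfun x (swap n)) / 2)"
proof (induction k arbitrary: n)
  case 0
  then show ?case by (simp add: field_simps)
next
  case (Suc k)
  show ?case
    by (simp add: block_def Suc) (simp add: field_simps)
qed

section \<open>Mean ergodicity\<close>

lemma apply_bcontfun_sum: "apply_bcontfun (sum f A) m = (\<Sum>k\<in>A. apply_bcontfun (f k :: linfty) m)"
  by (rule bounded_linear.linear[OF bounded_linear_coordinate, THEN linear_sum])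

lemma mean_ergodic_blockop: "mean_ergodic blockop"
  unfolding mean_ergodic_def
proof
  fix x :: linfty
  \<comment> \<open>The symmetric part of \<open>x\<close>, which is its component in the fixed
    space of \<open>blockop\<close>.\<close>
  define y where "y = (1/2) *\<^sub>R x + (1/2) *\<^sub>R Bcontfun (\<lambda>n. apply_bcontfun x (swap n))"
  have "(\<lambda>n. apply_bcontfun x (swap n)) \<in> bcontfun"
    by (rule bcontfun_normI[where b = "norm x"]) (auto intro: norm_bounded[where 'b = real, simplified])
  then have y: "apply_bcontfun y n = (apply_bcontfun x n + apply_bcontfun x (swap n)) / 2" for n
    by (simp add: y_def Bcontfun_inverse)
  let ?A = "\<lambda>n. (1 / real n) *\<^sub>R (\<Sum>k<n. (blockop ^^ k) x)"
  have bound: "norm (?A n - y) \<le> 2 * norm x / real n" if "n > 0" for n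
  proof (rule norm_bound)
    fix i
    let ?r = "ratio (i div 2)"
    let ?d = "(apply_bcontfun x i - apply_bcontfun x (swap i)) / 2"
    have r: "0 \<le> ?r" "?r < 1"
      by (simp_all add: ratio_nonneg ratio_less_one)
    have mean: "(1 / real n) * (\<Sum>k<n. c + q ^ k * d) - c = (1 / real n) * ((\<Sum>k<n. q ^ k) * d)"
      for c q d :: real
      using that by (simp add: sum.distrib sum_distrib_right distrib_left)
    have eq: "apply_bcontfun (?A n - y) i = (1 / real n) * ((\<Sum>k<n. (- ?r) ^ k) * ?d)"
      unfolding minus_bcontfun.rep_eq scaleR_bcontfun.rep_eq apply_bcontfun_sum
        apply_blockop_funpow y real_scaleR_def
      by (rule mean)
    \<comment> \<open>The geometric sum equals \<open>(1 - (- ?r) ^ n) / (1 + ?r)\<close>. Its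
      denominator is at least 1, so the bound 2 is the same for all blocks and all
      \<open>n\<close>.\<close>
    have "\<bar>1 - (- ?r) ^ n\<bar> \<le> 2"
      using power_le_one[of ?r n] r abs_triangle_ineq4[of 1 "(- ?r) ^ n"]
      by (simp add: power_abs)
    then have "\<bar>\<Sum>k<n. (- ?r) ^ k\<bar> \<le> 2"
      using r by (subst geometric_sum) (auto simp: divide_simps abs_if split: if_splits)
    moreover have "\<bar>?d\<bar> \<le> norm x"
      using norm_bounded[of x i] norm_bounded[of x "swap i"] by auto
    ultimately have "\<bar>(\<Sum>k<n. (- ?r) ^ k) * ?d\<bar> \<le> 2 * norm x"
      unfolding abs_mult by (intro mult_mono) auto
    then show "norm (apply_bcontfun (?A n - y) i) \<le> 2 * norm x / real n"
      unfolding eq abs_mult[of "1 / real n"] real_norm_def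
      using that by (simp add: divide_right_mono del: times_divide_eq_right)
  qed
  have "(\<lambda>n. ?A n - y) \<longlonglongrightarrow> 0"
  proof (rule Lim_null_comparison)
    show "eventually (\<lambda>n. norm (?A n - y) \<le> 2 * norm x / real n) sequentially"
      using eventually_gt_at_top[of 0] by eventually_elim (rule bound)
    show "(\<lambda>n. 2 * norm x / real n) \<longlonglongrightarrow> 0"
      by (rule lim_const_over_n)
  qed
  then have "?A \<longlonglongrightarrow> y"
    by (simp add: LIM_zero_iff)
  then show "convergent ?A"
    by (rule convergentI)
qed

section \<open>Failure of mean ergodicity for even powers\<close>

definition alternating :: linfty where
  "alternating = Bcontfun (\<lambda>n. (-1) ^ n)"

lemma apply_alternating [simp]: "apply_bcontfun alternating n = (-1) ^ n"
proof -
  have "(\<lambda>n::nat. (-1 :: real) ^ n) \<in> bcontfun"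
    by (rule bcontfun_normI[where b = 1]) (auto simp: power_abs)
  then show ?thesis
    by (simp add: alternating_def Bcontfun_inverse)
qed

text \<open>The vector is \<open>(1, -1)\<close> on every block, hence purely antisymmetric.\<close>

lemma apply_blockop_funpow_alternating:
  "apply_bcontfun ((blockop ^^ k) alternating) n = (- ratio (n div 2)) ^ k * (-1) ^ n"
  by (auto simp: apply_blockop_funpow swap_def elim!: oddE)

text \<open>Two limits fail to commute: for a fixed block the means tend to 0, while for a fixed
  \<open>n\<close> they tend to 1 as the block index grows.\<close>

lemma not_mean_ergodic_blockop_even_funpow:
  assumes "j \<ge> 1"
  shows "\<not> mean_ergodic (blockop ^^ (2 * j))"
proof
  let ?A = "\<lambda>n. (1 / real n) *\<^sub>R (\<Sum>k<n. ((blockop ^^ (2 * j)) ^^ k) alternating)"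
  assume "mean_ergodic (blockop ^^ (2 * j))"
  then obtain y where y: "?A \<longlonglongrightarrow> y"
    unfolding mean_ergodic_def convergent_def by blast
  have A: "apply_bcontfun (?A n) (2 * m) = (1 / real n) * (\<Sum>k<n. (ratio m ^ (2 * j)) ^ k)" for n m
    by (simp add: apply_bcontfun_sum funpow_mult apply_blockop_funpow_alternating power_mult)
  \<comment> \<open>Since \<open>j \<ge> 1\<close>, the ratio \<open>?q\<close> is below 1, so the
    geometric sums converge and division by \<open>n\<close> sends them to 0.\<close>
  have y0: "apply_bcontfun y (2 * m) = 0" for m
  proof -
    let ?q = "ratio m ^ (2 * j)"
    have q: "\<bar>?q\<bar> < 1"
      using ratio_nonneg[of m] ratio_less_one[of m] assms
      by (simp add: power_abs power_less_one_iff)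
    have "(\<lambda>n. (1 / real n) * (\<Sum>k<n. ?q ^ k)) \<longlonglongrightarrow> 0 * (1 / (1 - ?q))"
      using geometric_sums[of ?q] q by (intro tendsto_mult lim_1_over_n) (simp add: sums_def)
    moreover have "(\<lambda>n. apply_bcontfun (?A n) (2 * m)) \<longlonglongrightarrow> apply_bcontfun y (2 * m)"
      by (rule bounded_linear.tendsto[OF bounded_linear_coordinate y])
    ultimately show ?thesis
      unfolding A using LIMSEQ_unique by fastforce
  qed
  have "eventually (\<lambda>n. norm (?A n - y) < 1/2 \<and> n > 0) sequentially"
    using tendstoD[OF y, of "1/2"] eventually_gt_at_top[of 0]
    by (auto simp: dist_norm intro!: eventually_conj)
  then obtain n where n: "norm (?A n - y) < 1/2" "n > 0"
    using eventually_happens' sequentially_bot by blast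
  \<comment> \<open>A single \<open>n\<close> serves all blocks, because convergence in norm is
    uniform in the coordinate.\<close>
  have le: "(1 / real n) * (\<Sum>k<n. (ratio m ^ (2 * j)) ^ k) \<le> 1/2" for m
  proof -
    have "apply_bcontfun (?A n - y) (2 * m) \<le> norm (?A n - y)"
      using norm_bounded[of "?A n - y" "2 * m"] by simp
    with n(1) show ?thesis
      unfolding minus_bcontfun.rep_eq A y0 by linarith
  qed
  \<comment> \<open>With \<open>n\<close> fixed, letting \<open>m\<close> grow replaces
    \<open>ratio m\<close> by 1. The mean then equals 1, above the bound 1/2.\<close>
  have "(\<lambda>m. (1 / real n) * (\<Sum>k<n. (ratio m ^ (2 * j)) ^ k))
          \<longlonglongrightarrow> (1 / real n) * (\<Sum>k<n. (1 ^ (2 * j)) ^ k)"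
    by (intro tendsto_intros ratio_tendsto)
  then have "(1 / real n) * (\<Sum>k<n. (1 ^ (2 * j)) ^ k) \<le> 1/2"
    by (rule LIMSEQ_le_const2) (use le in blast)
  with n show False
    by simp
qed

section \<open>Failure of weak almost periodicity\<close>

lemma not_weakly_almost_periodic_blockop: "\<not> weakly_almost_periodic blockop"
proof -
  let ?S = "{(blockop ^^ n) alternating | n :: nat. n \<ge> 1}"
  obtain \<phi> :: "linfty \<Rightarrow>\<^sub>L real"
    where \<phi>: "\<And>x l. (\<lambda>m. apply_bcontfun x (2 * m)) \<longlonglongrightarrow> l \<Longrightarrow> blinfun_apply \<phi> x = l"
    using generalized_limit_exists[of "\<lambda>m. 2 * m"] by blast
  have "\<not> relatively_weakly_compact ?S"
  proof (rule not_relatively_weakly_compactI)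
    \<comment> \<open>The shift to \<open>Suc n\<close> matches the orbit, which starts at exponent
      1.\<close>
    show "(blockop ^^ Suc n) alternating \<in> ?S" for n
      by (auto simp del: funpow.simps)
    show "(\<lambda>n. apply_bcontfun ((blockop ^^ Suc n) alternating) m) \<longlonglongrightarrow> 0" for m
    proof -
      have "(\<lambda>n. (- ratio (m div 2)) ^ n) \<longlonglongrightarrow> 0"
        by (rule LIMSEQ_power_zero) (simp add: ratio_nonneg ratio_less_one)
      from tendsto_mult_left_zero[OF LIMSEQ_Suc[OF this]] show ?thesis
        unfolding apply_blockop_funpow_alternating .
    qed
    show "\<bar>blinfun_apply \<phi> y\<bar> = 1" if "y \<in> ?S" for y
    proof -
      from that obtain k where y: "y = (blockop ^^ k) alternating"
        by blast
      \<comment> \<open>The exponent \<open>k\<close> is fixed and the block index grows, so the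
        even coordinates of \<open>y\<close> converge and \<phi> takes their limit as its
        value.\<close>
      have "(\<lambda>m. (- ratio m) ^ k) \<longlonglongrightarrow> (- 1) ^ k"
        by (intro tendsto_intros ratio_tendsto)
      then have "blinfun_apply \<phi> y = (- 1) ^ k"
        by (intro \<phi>) (simp add: y apply_blockop_funpow_alternating)
      then show ?thesis
        by (simp add: power_abs)
    qed
  qed
  then show ?thesis
    unfolding weakly_almost_periodic_def by blast
qed

theorem mainTheorem4:
  shows "\<exists>T :: linfty \<Rightarrow> linfty.
           bounded_linear T \<and> positive_operator T \<and> onorm T \<le> 1 \<and>
           mean_ergodic T \<and>
           (\<forall>j::nat. j \<ge> 1 \<longrightarrow> \<not> mean_ergodic (T ^^ (2 * j))) \<and>
           \<not> weakly_almost_periodic T"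
  using bounded_linear_blockop positive_operator_blockop onorm_blockop_le mean_ergodic_blockop
    not_mean_ergodic_blockop_even_funpow not_weakly_almost_periodic_blockop
  by blast

end
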